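(* Let $q$ be a prime power and $n$ a positive integer. (a) For any $W_1,W_2\in\mathcal{M}_q(n)$, $$d(W_1,W_2)\geqslant d(\underline{W_1},\underline{W_2}),$$ with equality if and only if $\operatorname{ht}(W_1)=\operatorname{ht}(W_2)$. (b) For any integer $m\geqslant 0$ and any $W_1,W_2\in\mathcal{M}_q(n,m)$, $$d(W_1,W_2)=d(\underline{W_1},\underline{W_2})+|\dim(W_1)-\dim(W_2)|$$ and, consequently, $$d(\underline{W_1},\underline{W_2})\leqslant d(W_1,W_2)\leqslant 2\,d(\underline{W_1},\underline{W_2}),$$ where equality on the left-hand side holds if and only if $\dim(W_1)=\dim(W_2)$, and equality on the right-hand side holds if and only if $\underline{W_1}\subseteq\underline{W_2}$ or $\underline{W_2}\subseteq\underline{W_1}$.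
   Context: A multiset $M$ over a universe $U$ is given by a multiplicity function $\mu_M\colon U\to\{0,1,2,\ldots\}$; its underlying set is $\underline{M}=\{a\in U:\mu_M(a)>0\}$, its size is $|M|=\sum_{a\in U}\mu_M(a)$, and $M_1\subseteq M_2$ means $\mu_{M_1}\leqslant\mu_{M_2}$ pointwise. A multiset with all multiplicities in $\{0,1\}$ is identified with its underlying set. For a finite multiset $B=\{\!\{b_1,\ldots,b_m\}\!\}$ over $\mathbb{F}_q^n$ (the $b_i$ are not necessarily distinct), the multispan $\operatorname{mspan}_q(B)$ is the multiset over $\mathbb{F}_q^n$ in which the multiplicity of $v$ is the number of $m$-tuples $(\alpha_1,\ldots,\alpha_m)\in\mathbb{F}_q^m$ with $\sum_{i=1}^m\alpha_i b_i=v$; if $B$ is empty, $\operatorname{mspan}_q(B)=\{0\}$ (with $0$ of multiplicity $1$). A multiset $W$ over $\mathbb{F}_q^n$ is a multispace over $\mathbb{F}_q^n$ if $W=\operatorname{mspan}_q(B)$ for some multiset $B$; then $\operatorname{rank}(W)=|B|=\log_q|W|$, $\dim(W)=\dim(\operatorname{span}_q(B))$ (ordinary linear span), and the height of $W$ is $\operatorname{ht}(W)=\operatorname{rank}(W)-\dim(W)$. The underlying set $\underline{W}$ of a multispace is a subspace of $\mathbb{F}_q^n$, and every subspace of $\mathbb{F}_q^n$ is itself a multispace (with rank equal to its dimension). $\mathcal{M}_q(n,m)$ is the collection of all rank-$m$ multispaces over $\mathbb{F}_q^n$ and $\mathcal{M}_q(n)=\bigcup_{m\geqslant 0}\mathcal{M}_q(n,m)$.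 The poset $(\mathcal{M}_q(n),\subseteq)$ is a lattice with meet $\land$ and join $\lor$; the meet $W_1\land W_2$ is the multiset intersection $W_1\cap W_2$ (with multiplicity function $\min\{\mu_{W_1},\mu_{W_2}\}$). The metric $d$ on $\mathcal{M}_q(n)$ is $$d(W_1,W_2)=\operatorname{rank}(W_1\lor W_2)-\operatorname{rank}(W_1\land W_2)=\operatorname{rank}(W_1)+\operatorname{rank}(W_2)-2\operatorname{rank}(W_1\land W_2).$$ In particular, for subspaces $V_1,V_2$ of $\mathbb{F}_q^n$, $d(V_1,V_2)=\dim(V_1)+\dim(V_2)-2\dim(V_1\cap V_2)$. *)

theory Defs
  imports "HOL-Analysis.Analysis" "HOL-Algebra.Lattice"
begin

text \<open>
  The field \<open>\<F>\<^sub>q\<close> is an arbitrary finite field type \<open>'a\<close> with \<open>q = CARD('a)\<close>, and \<open>\<F>\<^sub>q\<^sup>n\<close> is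
  \<open>'a ^ 'n\<close> with \<open>n = CARD('n) \<ge> 1\<close>.  Linear algebra over \<open>\<F>\<^sub>q\<close> is the library's \<open>vec\<close>
  interpretation.
\<close>

section \<open>Multispans\<close>

text \<open>One element for every coefficient tuple, represented as a list of the length of \<open>bs\<close>.\<close>

definition mspan_list :: "('a::{field,finite} ^ 'n) list \<Rightarrow> ('a ^ 'n) multiset" where
  "mspan_list bs =
     image_mset (\<lambda>as. \<Sum>i<length bs. as ! i *s bs ! i) (mset_set {as :: 'a list. length as = length bs})"

text \<open>
  The enumeration \<open>bs\<close> of the finite multiset \<open>B\<close> is immaterial, see \<open>mspan_mset\<close> and
  \<open>count_mspan\<close> below.
\<close>

definition mspan :: "('a::{field,finite} ^ 'n) multiset \<Rightarrow> ('a ^ 'n) multiset" where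
  "mspan B = mspan_list (SOME bs. mset bs = B)"

definition multispace :: "('a::{field,finite} ^ 'n) multiset \<Rightarrow> bool" where
  "multispace W \<longleftrightarrow> (\<exists>B. W = mspan B)"

text \<open>
  Rank and dimension do not depend on the generating multiset; see \<open>mrank_mspan\<close> and
  \<open>mdim_mspan\<close> below.
\<close>

definition mrank :: "('a::{field,finite} ^ 'n) multiset \<Rightarrow> nat" where
  "mrank W = (THE m. \<exists>B. W = mspan B \<and> m = size B)"

definition mdim :: "('a::{field,finite} ^ 'n) multiset \<Rightarrow> nat" where
  "mdim W = (THE d. \<exists>B. W = mspan B \<and> d = vec.dim (vec.span (set_mset B)))"

definition mheight :: "('a::{field,finite} ^ 'n) multiset \<Rightarrow> int" where
  "mheight W = int (mrank W) - int (mdim W)"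

text \<open>The underlying set, regarded as a multiset with all multiplicities in \<open>{0, 1}\<close>.\<close>

definition underlying :: "'b multiset \<Rightarrow> 'b multiset" where
  "underlying W = mset_set (set_mset W)"


section \<open>The lattice of multispaces and its metric\<close>

definition multispaces :: "('a::{field,finite} ^ 'n) multiset set" where
  "multispaces = {W. multispace W}"

definition multispaces_of_rank :: "nat \<Rightarrow> ('a::{field,finite} ^ 'n) multiset set" where
  "multispaces_of_rank m = {W. multispace W \<and> mrank W = m}"

definition multispace_poset :: "('a::{field,finite} ^ 'n) multiset gorder" where
  "multispace_poset = \<lparr>carrier = multispaces, eq = (=), le = (\<subseteq>#)\<rparr>"

definition multispace_dist :: "('a::{field,finite} ^ 'n) multiset \<Rightarrow> ('a ^ 'n) multiset \<Rightarrow> int" where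
  "multispace_dist W\<^sub>1 W\<^sub>2 = int (mrank (W\<^sub>1 \<squnion>\<^bsub>multispace_poset\<^esub> W\<^sub>2)) - int (mrank (W\<^sub>1 \<sqinter>\<^bsub>multispace_poset\<^esub> W\<^sub>2))"


section \<open>The notions are well defined\<close>

lemma finite_tuples: "finite {as :: 'a::finite list. length as = k}"
  using finite_lists_length_eq[of "UNIV :: 'a set" k] by simp

lemma count_mspan_list:
  fixes bs :: "('a::{field,finite} ^ 'n) list"
  shows "count (mspan_list bs) v =
    card {as :: 'a list. length as = length bs \<and> (\<Sum>i<length bs. as ! i *s bs ! i) = v}"
proof -
  have "count (mspan_list bs) v =
      card {as \<in> {as :: 'a list. length as = length bs}. (\<Sum>i<length bs. as ! i *s bs ! i) = v}"
    unfolding mspan_list_def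
    by (subst count_image_mset')
      (auto simp: finite_tuples sum.If_cases Int_def intro!: arg_cong[of _ _ card])
  then show ?thesis by simp
qed

lemma count_mspan_list_Nil: "count (mspan_list []) v = (if v = 0 then 1 else 0)"
  by (auto simp: mspan_list_def)

lemma count_mspan_list_Cons:
  fixes b :: "'a::{field,finite} ^ 'n"
  shows "count (mspan_list (b # bs)) v = (\<Sum>a\<in>UNIV. count (mspan_list bs) (v - a *s b))"
proof -
  let ?C = "\<lambda>a. {as :: 'a list. length as = length bs \<and> (\<Sum>i<length bs. as ! i *s bs ! i) = v - a *s b}"
  have "{as :: 'a list. length as = length (b # bs) \<and>
           (\<Sum>i<length (b # bs). as ! i *s (b # bs) ! i) = v} = (\<Union>a. Cons a ` ?C a)" (is "?L = ?R")
  proof (rule Set.set_eqI)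
    fix as :: "'a list"
    show "as \<in> ?L \<longleftrightarrow> as \<in> ?R"
    proof (cases as)
      case (Cons a as')
      then show ?thesis
        by (auto simp del: sum.lessThan_Suc simp: sum.lessThan_Suc_shift algebra_simps image_iff eq_diff_eq)
    qed auto
  qed
  then have "count (mspan_list (b # bs)) v = card (\<Union>a. Cons a ` ?C a)"
    by (simp only: count_mspan_list)
  also have "\<dots> = (\<Sum>a\<in>UNIV. card (Cons a ` ?C a))"
    by (rule card_UN_disjoint) (auto intro: finite_subset[OF _ finite_tuples[of "length bs"]])
  also have "\<dots> = (\<Sum>a\<in>UNIV. card (?C a))"
    by (intro sum.cong refl card_image) auto
  finally show ?thesis by (simp only: count_mspan_list)
qed

lemma count_mspan_list_span:
  fixes bs :: "('a::{field,finite} ^ 'n) list"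
  shows "vec.dim (set bs) \<le> length bs \<and>
    (\<forall>v. count (mspan_list bs) v =
      (if v \<in> vec.span (set bs) then CARD('a) ^ (length bs - vec.dim (set bs)) else 0))"
proof (induction bs)
  case Nil
  show ?case by (simp add: count_mspan_list_Nil)
next
  case (Cons b bs)
  let ?S = "set bs" and ?k = "length bs - vec.dim (set bs)"
  have IH: "count (mspan_list bs) v = (if v \<in> vec.span ?S then CARD('a) ^ ?k else 0)" for v
    using Cons by blast
  have le: "vec.dim ?S \<le> length bs" using Cons by blast
  show ?case
  proof (cases "b \<in> vec.span ?S")
    case True
    have sp: "vec.span (insert b ?S) = vec.span ?S"
      using True by (rule vec.span_redundant)
    have "v - a *s b \<in> vec.span ?S \<longleftrightarrow> v \<in> vec.span ?S" for v a
      using vec.span_add_eq2[of "- (a *s b)" ?S v] True vec.span_scale vec.span_neg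
      by (metis add.commute diff_conv_add_uminus vec.span_add_eq)
    then show ?thesis
      using True le sp by (auto simp: count_mspan_list_Cons IH vec.dim_insert Suc_diff_le)
  next
    case False
    have uniq: "a = a'" if "v - a *s b \<in> vec.span ?S" "v - a' *s b \<in> vec.span ?S" for v a a'
    proof (rule ccontr)
      assume "a \<noteq> a'"
      have "(a' - a) *s b \<in> vec.span ?S"
        using vec.span_diff[OF that] by (simp add: vec.scale_left_diff_distrib)
      then have "(1 / (a' - a)) *s ((a' - a) *s b) \<in> vec.span ?S"
        by (rule vec.span_scale)
      with \<open>a \<noteq> a'\<close> False show False by (simp only: vec.scale_scale) simp
    qed
    have "(\<Sum>a\<in>UNIV. count (mspan_list bs) (v - a *s b)) =
        (if v \<in> vec.span (insert b ?S) then CARD('a) ^ ?k else 0)" for v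
    proof (cases "v \<in> vec.span (insert b ?S)")
      case True
      then obtain a where a: "v - a *s b \<in> vec.span ?S"
        by (auto simp: vec.span_breakdown_eq)
      have "(\<Sum>a\<in>UNIV. count (mspan_list bs) (v - a *s b)) =
          (\<Sum>a'\<in>UNIV. if a' = a then CARD('a) ^ ?k else 0)"
        using a uniq by (intro sum.cong) (auto simp: IH)
      with True show ?thesis by simp
    next
      case False
      then have "v - a *s b \<notin> vec.span ?S" for a
        by (auto simp: vec.span_breakdown_eq)
      with False show ?thesis by (simp add: IH)
    qed
    then show ?thesis
      using False le by (simp add: count_mspan_list_Cons vec.dim_insert)
  qed
qed

lemma mspan_mset: "mspan (mset bs) = mspan_list bs"
proof -
  define cs where "cs = (SOME cs. mset cs = mset bs)"
  have cs: "mset cs = mset bs" unfolding cs_def by (rule someI) (rule refl)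
  then have "set cs = set bs" "length cs = length bs"
    by (metis set_mset_mset, metis size_mset)
  then have "mspan_list cs = mspan_list bs"
    by (intro multiset_eqI) (simp add: count_mspan_list_span)
  then show ?thesis by (simp add: mspan_def cs_def)
qed

lemma mspan_empty: "mspan {#} = {#0#}"
  by (simp add: multiset_eq_iff mspan_mset[of "[]", simplified] count_mspan_list_Nil)

lemma dim_le_size: "vec.dim (set_mset B) \<le> size B"
  for B :: "('a::{field,finite} ^ 'n) multiset"
proof -
  obtain bs where "B = mset bs" using ex_mset[of B] by metis
  then show ?thesis using count_mspan_list_span[of bs] by simp
qed

lemma count_mspan:
  fixes B :: "('a::{field,finite} ^ 'n) multiset"
  shows "count (mspan B) v =
    (if v \<in> vec.span (set_mset B) then CARD('a) ^ (size B - vec.dim (set_mset B)) else 0)"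
proof -
  obtain bs where "B = mset bs" using ex_mset[of B] by metis
  then show ?thesis using count_mspan_list_span[of bs] by (simp add: mspan_mset)
qed

lemma set_mset_mspan: "set_mset (mspan B) = vec.span (set_mset B)"
proof (rule Set.set_eqI)
  show "v \<in># mspan B \<longleftrightarrow> v \<in> vec.span (set_mset B)" for v
    unfolding count_greater_zero_iff[symmetric] count_mspan by simp
qed

lemma size_mspan: "size (mspan B) = CARD('a) ^ size B"
  for B :: "('a::{field,finite} ^ 'n) multiset"
proof -
  obtain bs where "B = mset bs" using ex_mset[of B] by metis
  then show ?thesis
    using card_lists_length_eq[of "UNIV :: 'a set" "length bs"]
    by (simp add: mspan_mset mspan_list_def finite_tuples)
qed

lemma one_less_card_field: "1 < CARD('a::{field,finite})"
  using card_mono[of "UNIV :: 'a set" "{0, 1}"] by simp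

lemma mrank_mspan: "mrank (mspan B) = size B"
  unfolding mrank_def
proof (rule the_equality)
  show "m = size B" if "\<exists>C. mspan B = mspan C \<and> m = size C" for m
    using that one_less_card_field size_mspan by (metis power_inject_exp)
qed blast

lemma mrank_log: "multispace W \<Longrightarrow> real (mrank W) = log CARD('a) (size W)"
  for W :: "('a::{field,finite} ^ 'n) multiset"
  using one_less_card_field[where 'a='a]
  by (auto simp: multispace_def mrank_mspan size_mspan log_nat_power)

lemma mdim_mspan: "mdim (mspan B) = vec.dim (vec.span (set_mset B))"
  unfolding mdim_def
  by (rule the_equality) (auto simp flip: set_mset_mspan)

lemma mdim_le_mrank: "multispace W \<Longrightarrow> mdim W \<le> mrank W"
  by (auto simp: multispace_def mrank_mspan mdim_mspan dim_le_size)

lemma multispace_exists: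
  fixes V :: "('a::{field,finite} ^ 'n) set"
  assumes "vec.subspace V"
  shows "\<exists>W. multispace W \<and> mrank W = vec.dim V + h \<and> (\<forall>v. count W v = (if v \<in> V then CARD('a) ^ h else 0))"
proof -
  obtain B where B: "B \<subseteq> V" "vec.independent B" "V \<subseteq> vec.span B" "card B = vec.dim V"
    using vec.basis_exists by blast
  have sp: "vec.span B = V"
    using B assms by (metis subset_antisym vec.span_minimal)
  have fin: "finite B" by simp
  define C where "C = mset_set B + replicate_mset h 0"
  have "vec.span (set_mset C) = V"
    using sp fin by (cases "h = 0") (auto simp: C_def)
  moreover from this have "vec.dim (set_mset C) = vec.dim V"
    by (metis vec.dim_span)
  moreover have "size C = vec.dim V + h" using B(4) by (simp add: C_def)
  ultimately show ?thesis
    by (intro exI[of _ "mspan C"]) (auto simp: multispace_def mrank_mspan count_mspan)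
qed

lemma multispace_count:
  fixes W :: "('a::{field,finite} ^ 'n) multiset"
  assumes "multispace W"
  shows "vec.subspace (set_mset W)" "mdim W = vec.dim (set_mset W)"
    "count W v = (if v \<in> set_mset W then CARD('a) ^ (mrank W - mdim W) else 0)"
  using assms by (auto simp: multispace_def set_mset_mspan mdim_mspan mrank_mspan count_mspan)

lemma multispace_le_iff:
  fixes W W' :: "('a::{field,finite} ^ 'n) multiset"
  assumes "multispace W" "multispace W'"
  shows "W \<subseteq># W' \<longleftrightarrow> set_mset W \<subseteq> set_mset W' \<and> mrank W - mdim W \<le> mrank W' - mdim W'"
proof -
  have zero: "0 \<in> set_mset W" using multispace_count(1)[OF assms(1)] vec.subspace_0 by blast
  show ?thesis
  proof
    assume le: "W \<subseteq># W'"
    then have sub: "set_mset W \<subseteq> set_mset W'" by (rule set_mset_mono)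
    have "count W 0 \<le> count W' 0" using le by (simp add: mset_subset_eq_count)
    then have "CARD('a) ^ (mrank W - mdim W) \<le> CARD('a) ^ (mrank W' - mdim W')"
      using zero sub multispace_count(3)[OF assms(1), of 0] multispace_count(3)[OF assms(2), of 0]
      by (simp add: subset_iff)
    then show "set_mset W \<subseteq> set_mset W' \<and> mrank W - mdim W \<le> mrank W' - mdim W'"
      using sub one_less_card_field[where 'a='a] power_increasing_iff by blast
  next
    assume *: "set_mset W \<subseteq> set_mset W' \<and> mrank W - mdim W \<le> mrank W' - mdim W'"
    then have "CARD('a) ^ (mrank W - mdim W) \<le> CARD('a) ^ (mrank W' - mdim W')"
      using one_less_card_field[where 'a='a] power_increasing_iff by blast
    then show "W \<subseteq># W'"
      using * by (intro mset_subset_eqI)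
        (auto simp: multispace_count(3)[OF assms(1)] multispace_count(3)[OF assms(2)])
  qed
qed

lemma multispace_underlying:
  fixes W :: "('a::{field,finite} ^ 'n) multiset"
  assumes "multispace W"
  shows "multispace (underlying W)" "mrank (underlying W) = mdim W" "mdim (underlying W) = mdim W"
proof -
  obtain U where U: "multispace U" "mrank U = vec.dim (set_mset W)"
    "\<And>v. count U v = (if v \<in> set_mset W then 1 else 0)"
    using multispace_exists[OF multispace_count(1)[OF assms], of 0] by auto
  have "U = underlying W"
    by (intro multiset_eqI) (simp add: U(3) underlying_def count_mset_set')
  then show "multispace (underlying W)" "mrank (underlying W) = mdim W"
    "mdim (underlying W) = mdim W"
    using U(1,2) multispace_count(2)[OF assms] multispace_count(2)[OF U(1)]
    by (auto simp: underlying_def)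
qed

lemma multispace_eqI:
  fixes W W' :: "('a::{field,finite} ^ 'n) multiset"
  assumes "multispace W" "multispace W'" "set_mset W = set_mset W'" "mrank W = mrank W'"
  shows "W = W'"
  using assms multispace_count(2)[OF assms(1)] multispace_count(2)[OF assms(2)]
    multispace_le_iff[OF assms(1,2)] multispace_le_iff[OF assms(2,1)]
  by (intro subset_mset.antisym) auto

lemma multispace_glb:
  fixes W\<^sub>1 W\<^sub>2 :: "('a::{field,finite} ^ 'n) multiset"
  assumes "multispace W\<^sub>1" "multispace W\<^sub>2"
  shows "greatest multispace_poset (W\<^sub>1 \<inter># W\<^sub>2) (Lower multispace_poset {W\<^sub>1, W\<^sub>2})"
    "mrank (W\<^sub>1 \<inter># W\<^sub>2) = vec.dim (set_mset W\<^sub>1 \<inter> set_mset W\<^sub>2) +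
       min (mrank W\<^sub>1 - mdim W\<^sub>1) (mrank W\<^sub>2 - mdim W\<^sub>2)"
proof -
  let ?h = "min (mrank W\<^sub>1 - mdim W\<^sub>1) (mrank W\<^sub>2 - mdim W\<^sub>2)"
  have "vec.subspace (set_mset W\<^sub>1 \<inter> set_mset W\<^sub>2)"
    by (intro vec.subspace_inter multispace_count assms)
  then obtain U where U: "multispace U" "mrank U = vec.dim (set_mset W\<^sub>1 \<inter> set_mset W\<^sub>2) + ?h"
    "\<And>v. count U v = (if v \<in> set_mset W\<^sub>1 \<inter> set_mset W\<^sub>2 then CARD('a) ^ ?h else 0)"
    using multispace_exists[of "set_mset W\<^sub>1 \<inter> set_mset W\<^sub>2" ?h] by metis
  have "count U v = min (count W\<^sub>1 v) (count W\<^sub>2 v)" for v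
    using one_less_card_field[where 'a='a]
    by (auto simp: U(3) multispace_count(3)[OF assms(1), of v]
        multispace_count(3)[OF assms(2), of v] min_def simp del: count_greater_zero_iff)
  then have "U = W\<^sub>1 \<inter># W\<^sub>2" by (intro multiset_eqI) simp
  then show "greatest multispace_poset (W\<^sub>1 \<inter># W\<^sub>2) (Lower multispace_poset {W\<^sub>1, W\<^sub>2})"
    "mrank (W\<^sub>1 \<inter># W\<^sub>2) = vec.dim (set_mset W\<^sub>1 \<inter> set_mset W\<^sub>2) + ?h"
    using U(1,2) assms by (auto simp: greatest_def Lower_def multispace_poset_def multispaces_def)
qed

lemma multispace_lub:
  fixes W\<^sub>1 W\<^sub>2 :: "('a::{field,finite} ^ 'n) multiset"
  assumes "multispace W\<^sub>1" "multispace W\<^sub>2"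
  obtains U where "least multispace_poset U (Upper multispace_poset {W\<^sub>1, W\<^sub>2})"
    "mrank U + mrank (W\<^sub>1 \<inter># W\<^sub>2) = mrank W\<^sub>1 + mrank W\<^sub>2"
proof -
  let ?h = "max (mrank W\<^sub>1 - mdim W\<^sub>1) (mrank W\<^sub>2 - mdim W\<^sub>2)"
  define V where "V = {x + y |x y. x \<in> set_mset W\<^sub>1 \<and> y \<in> set_mset W\<^sub>2}"
  have sub: "vec.subspace (set_mset W\<^sub>1)" "vec.subspace (set_mset W\<^sub>2)"
    using assms multispace_count(1) by blast+
  have V: "vec.subspace V" unfolding V_def using vec.subspace_sums[OF sub] .
  then obtain U where U: "multispace U" "mrank U = vec.dim V + ?h"
    "\<And>v. count U v = (if v \<in> V then CARD('a) ^ ?h else 0)"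
    using multispace_exists[of V ?h] by metis
  have set_U: "set_mset U = V"
  proof (rule Set.set_eqI)
    show "v \<in># U \<longleftrightarrow> v \<in> V" for v
      unfolding count_greater_zero_iff[symmetric] U(3) by simp
  qed
  have ht_U: "mrank U - mdim U = ?h"
    using U(2) multispace_count(2)[OF U(1)] by (simp add: set_U)
  have zero: "0 \<in> set_mset W\<^sub>1" "0 \<in> set_mset W\<^sub>2"
    using sub vec.subspace_0 by blast+
  have "x + 0 \<in> V" if "x \<in> set_mset W\<^sub>1" for x
    unfolding V_def using that zero(2) by blast
  then have "set_mset W\<^sub>1 \<subseteq> V" by auto
  moreover have "0 + y \<in> V" if "y \<in> set_mset W\<^sub>2" for y
    unfolding V_def using that zero(1) by blast
  then have "set_mset W\<^sub>2 \<subseteq> V" by auto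
  ultimately have ub: "W\<^sub>1 \<subseteq># U" "W\<^sub>2 \<subseteq># U"
    using multispace_le_iff[OF assms(1) U(1)] multispace_le_iff[OF assms(2) U(1)]
    by (simp_all only: set_U ht_U) simp_all
  have least: "U \<subseteq># X" if X: "multispace X" "W\<^sub>1 \<subseteq># X" "W\<^sub>2 \<subseteq># X" for X
  proof -
    have "V \<subseteq> set_mset X"
      using set_mset_mono[OF X(2)] set_mset_mono[OF X(3)] vec.subspace_add[OF multispace_count(1)[OF X(1)]]
      unfolding V_def by blast
    then show ?thesis
      using X multispace_le_iff[OF assms(1) X(1)] multispace_le_iff[OF assms(2) X(1)]
        multispace_le_iff[OF U(1) X(1)]
      by (simp only: set_U ht_U) simp
  qed
  have "vec.dim V + vec.dim (set_mset W\<^sub>1 \<inter> set_mset W\<^sub>2) = mdim W\<^sub>1 + mdim W\<^sub>2"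
    unfolding V_def multispace_count(2)[OF assms(1)] multispace_count(2)[OF assms(2)]
    by (rule vec.dim_sums_Int[OF sub])
  then have "mrank U + mrank (W\<^sub>1 \<inter># W\<^sub>2) = mrank W\<^sub>1 + mrank W\<^sub>2"
    using mdim_le_mrank[OF assms(1)] mdim_le_mrank[OF assms(2)]
    by (simp add: U(2) multispace_glb(2)[OF assms])
  moreover have "least multispace_poset U (Upper multispace_poset {W\<^sub>1, W\<^sub>2})"
    using U(1) ub least assms
    by (auto simp: least_def Upper_def multispace_poset_def multispaces_def)
  ultimately show thesis using that by blast
qed

lemma lattice_multispace_poset:
  "lattice (multispace_poset :: ('a::{field,finite} ^ 'n) multiset gorder)"
proof unfold_locales
  fix W\<^sub>1 W\<^sub>2 :: "('a ^ 'n) multiset"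
  assume "W\<^sub>1 \<in> carrier multispace_poset" "W\<^sub>2 \<in> carrier multispace_poset"
  then have *: "multispace W\<^sub>1" "multispace W\<^sub>2"
    by (simp_all add: multispace_poset_def multispaces_def)
  show "\<exists>s. least multispace_poset s (Upper multispace_poset {W\<^sub>1, W\<^sub>2})"
    using multispace_lub[OF *] by blast
  show "\<exists>s. greatest multispace_poset s (Lower multispace_poset {W\<^sub>1, W\<^sub>2})"
    using multispace_glb(1)[OF *] by blast
qed (auto simp: multispace_poset_def)

lemma multispace_meet:
  fixes W\<^sub>1 W\<^sub>2 :: "('a::{field,finite} ^ 'n) multiset"
  assumes "multispace W\<^sub>1" "multispace W\<^sub>2"
  shows "W\<^sub>1 \<sqinter>\<^bsub>multispace_poset\<^esub> W\<^sub>2 = W\<^sub>1 \<inter># W\<^sub>2"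
proof -
  interpret L: lattice "multispace_poset :: ('a ^ 'n) multiset gorder"
    by (rule lattice_multispace_poset)
  show ?thesis
    unfolding meet_def inf_def
    using multispace_glb(1)[OF assms] L.greatest_unique by (metis someI)
qed

lemma multispace_dist_eq:
  fixes W\<^sub>1 W\<^sub>2 :: "('a::{field,finite} ^ 'n) multiset"
  assumes "multispace W\<^sub>1" "multispace W\<^sub>2"
  shows "multispace_dist W\<^sub>1 W\<^sub>2 =
    int (mrank W\<^sub>1) + int (mrank W\<^sub>2) - 2 * int (mrank (W\<^sub>1 \<sqinter>\<^bsub>multispace_poset\<^esub> W\<^sub>2))"
proof -
  interpret L: lattice "multispace_poset :: ('a ^ 'n) multiset gorder"
    by (rule lattice_multispace_poset)
  obtain U where U: "least multispace_poset U (Upper multispace_poset {W\<^sub>1, W\<^sub>2})"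
    "mrank U + mrank (W\<^sub>1 \<inter># W\<^sub>2) = mrank W\<^sub>1 + mrank W\<^sub>2"
    using multispace_lub[OF assms] by blast
  have "W\<^sub>1 \<squnion>\<^bsub>multispace_poset\<^esub> W\<^sub>2 = U"
    unfolding join_def sup_def
    using U(1) L.least_unique by (metis someI)
  with U(2) show ?thesis
    by (simp add: multispace_dist_def multispace_meet[OF assms])
qed

lemma multispace_dist_underlying:
  fixes W\<^sub>1 W\<^sub>2 :: "('a::{field,finite} ^ 'n) multiset"
  assumes "multispace W\<^sub>1" "multispace W\<^sub>2"
  shows "multispace_dist (underlying W\<^sub>1) (underlying W\<^sub>2) =
    int (mdim W\<^sub>1) + int (mdim W\<^sub>2) - 2 * int (vec.dim (set_mset W\<^sub>1 \<inter> set_mset W\<^sub>2))"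
proof -
  note u = multispace_underlying[OF assms(1)] multispace_underlying[OF assms(2)]
  have set: "set_mset (underlying W) = set_mset W" for W :: "'c multiset"
    by (simp add: underlying_def)
  show ?thesis
    by (simp add: multispace_dist_eq multispace_meet multispace_glb(2) u set)
qed

end

theory Submission
  imports Defs
begin

text \<open>
  A multispace is determined by its underlying subspace and its height \<open>h\<close>, and the meet
  intersects the subspaces and takes the smaller height. Hence
  \<open>d(W\<^sub>1, W\<^sub>2) = d(V\<^sub>1, V\<^sub>2) + \<bar>h\<^sub>1 - h\<^sub>2\<bar>\<close> for the underlying subspaces \<open>V\<^sub>1\<close>, \<open>V\<^sub>2\<close>. For equal ranks the
  last summand is \<open>\<bar>dim V\<^sub>1 - dim V\<^sub>2\<bar>\<close>, which is at most \<open>d(V\<^sub>1, V\<^sub>2)\<close>, with equality exactly when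
  \<open>V\<^sub>1 \<inter> V\<^sub>2\<close> is one of the two subspaces.
\<close>

text \<open>Each rank is dimension plus height, and the rank of the meet contributes the smaller
  height. The identity \<open>h\<^sub>1 + h\<^sub>2 - 2 * min h\<^sub>1 h\<^sub>2 = \<bar>h\<^sub>1
  - h\<^sub>2\<bar>\<close> then splits off the height term.\<close>

lemma multispace_dist_eq_underlying_plus_height:
  fixes W\<^sub>1 W\<^sub>2 :: "('a::{field,finite} ^ 'n) multiset"
  assumes "multispace W\<^sub>1" "multispace W\<^sub>2"
  shows "multispace_dist W\<^sub>1 W\<^sub>2 =
    multispace_dist (underlying W\<^sub>1) (underlying W\<^sub>2) + \<bar>mheight W\<^sub>1 - mheight W\<^sub>2\<bar>"
  \<comment> \<open>These bounds make the truncated differences in \<open>multispace_glb\<close>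
    agree with the integer heights.\<close>
  using mdim_le_mrank[OF assms(1)] mdim_le_mrank[OF assms(2)]
  unfolding multispace_dist_underlying[OF assms] multispace_dist_eq[OF assms]
    multispace_meet[OF assms] multispace_glb(2)[OF assms] mheight_def
  by (auto simp: min_def of_nat_diff)

text \<open>In finite dimension, a subspace of \<open>V\<^sub>1\<close> with the dimension of
  \<open>V\<^sub>1\<close> is \<open>V\<^sub>1\<close> itself; apply this to the
  intersection.\<close>

lemma dim_Int_eq_left_iff:
  fixes V\<^sub>1 V\<^sub>2 :: "('a::field ^ 'n) set"
  assumes "vec.subspace V\<^sub>1" "vec.subspace V\<^sub>2"
  shows "vec.dim (V\<^sub>1 \<inter> V\<^sub>2) = vec.dim V\<^sub>1 \<longleftrightarrow> V\<^sub>1 \<subseteq> V\<^sub>2"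
proof
  assume "vec.dim (V\<^sub>1 \<inter> V\<^sub>2) = vec.dim V\<^sub>1"
  then have "V\<^sub>1 \<inter> V\<^sub>2 = V\<^sub>1"
    by (intro vec.subspace_dim_equal vec.subspace_inter assms) auto
  then show "V\<^sub>1 \<subseteq> V\<^sub>2" by blast
qed (simp add: Int_absorb2)

text \<open>With \<open>a\<close> and \<open>b\<close> the codimensions of the intersection in the
  two underlying subspaces, the claim is \<open>\<bar>a - b\<bar> \<le> a + b\<close> for
  \<open>a, b \<ge> 0\<close>, with equality iff \<open>a = 0\<close> or
  \<open>b = 0\<close>.\<close>

lemma abs_mdim_diff_le_multispace_dist_underlying:
  fixes W\<^sub>1 W\<^sub>2 :: "('a::{field,finite} ^ 'n) multiset"
  assumes "multispace W\<^sub>1" "multispace W\<^sub>2"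
  shows "\<bar>int (mdim W\<^sub>1) - int (mdim W\<^sub>2)\<bar> \<le> multispace_dist (underlying W\<^sub>1) (underlying W\<^sub>2)"
    and "\<bar>int (mdim W\<^sub>1) - int (mdim W\<^sub>2)\<bar> = multispace_dist (underlying W\<^sub>1) (underlying W\<^sub>2) \<longleftrightarrow>
      set_mset W\<^sub>1 \<subseteq> set_mset W\<^sub>2 \<or> set_mset W\<^sub>2 \<subseteq> set_mset W\<^sub>1"
proof -
  let ?i = "vec.dim (set_mset W\<^sub>1 \<inter> set_mset W\<^sub>2)"
  note sub = multispace_count(1)[OF assms(1)] multispace_count(1)[OF assms(2)]
  have le: "?i \<le> mdim W\<^sub>1" "?i \<le> mdim W\<^sub>2"
    unfolding multispace_count(2)[OF assms(1)] multispace_count(2)[OF assms(2)]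
    by (auto intro: vec.dim_subset)
  have eq: "?i = mdim W\<^sub>1 \<longleftrightarrow> set_mset W\<^sub>1 \<subseteq> set_mset W\<^sub>2"
    "?i = mdim W\<^sub>2 \<longleftrightarrow> set_mset W\<^sub>2 \<subseteq> set_mset W\<^sub>1"
    using dim_Int_eq_left_iff[OF sub] dim_Int_eq_left_iff[OF sub(2,1)]
    by (simp_all add: multispace_count(2)[OF assms(1)] multispace_count(2)[OF assms(2)] Int_commute)
  show "\<bar>int (mdim W\<^sub>1) - int (mdim W\<^sub>2)\<bar> \<le> multispace_dist (underlying W\<^sub>1) (underlying W\<^sub>2)"
    using le unfolding multispace_dist_underlying[OF assms] by linarith
  show "\<bar>int (mdim W\<^sub>1) - int (mdim W\<^sub>2)\<bar> = multispace_dist (underlying W\<^sub>1) (underlying W\<^sub>2) \<longleftrightarrow>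
      set_mset W\<^sub>1 \<subseteq> set_mset W\<^sub>2 \<or> set_mset W\<^sub>2 \<subseteq> set_mset W\<^sub>1"
    \<comment> \<open>Trading the inclusions for equations between dimensions leaves pure linear
      arithmetic.\<close>
    using le unfolding multispace_dist_underlying[OF assms] eq[symmetric] by linarith
qed

theorem proposition2p8:
  shows
    "(\<forall>W\<^sub>1 \<in> multispaces. \<forall>W\<^sub>2 \<in> (multispaces :: ('a::{field,finite} ^ 'n) multiset set).
        multispace_dist W\<^sub>1 W\<^sub>2 \<ge> multispace_dist (underlying W\<^sub>1) (underlying W\<^sub>2) \<and>
        (multispace_dist W\<^sub>1 W\<^sub>2 = multispace_dist (underlying W\<^sub>1) (underlying W\<^sub>2) \<longleftrightarrow> mheight W\<^sub>1 = mheight W\<^sub>2)) \<and>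
     (\<forall>m. \<forall>W\<^sub>1 \<in> multispaces_of_rank m. \<forall>W\<^sub>2 \<in> (multispaces_of_rank m :: ('a ^ 'n) multiset set).
        multispace_dist W\<^sub>1 W\<^sub>2 =
          multispace_dist (underlying W\<^sub>1) (underlying W\<^sub>2) + \<bar>int (mdim W\<^sub>1) - int (mdim W\<^sub>2)\<bar> \<and>
        multispace_dist (underlying W\<^sub>1) (underlying W\<^sub>2) \<le> multispace_dist W\<^sub>1 W\<^sub>2 \<and>
        multispace_dist W\<^sub>1 W\<^sub>2 \<le> 2 * multispace_dist (underlying W\<^sub>1) (underlying W\<^sub>2) \<and>
        (multispace_dist (underlying W\<^sub>1) (underlying W\<^sub>2) = multispace_dist W\<^sub>1 W\<^sub>2 \<longleftrightarrow> mdim W\<^sub>1 = mdim W\<^sub>2) \<and>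
        (multispace_dist W\<^sub>1 W\<^sub>2 = 2 * multispace_dist (underlying W\<^sub>1) (underlying W\<^sub>2) \<longleftrightarrow>
           set_mset W\<^sub>1 \<subseteq> set_mset W\<^sub>2 \<or> set_mset W\<^sub>2 \<subseteq> set_mset W\<^sub>1))"
proof (intro conjI allI ballI)
  fix W\<^sub>1 W\<^sub>2 :: "('a ^ 'n) multiset"
  assume "W\<^sub>1 \<in> multispaces" "W\<^sub>2 \<in> multispaces"
  then have W: "multispace W\<^sub>1" "multispace W\<^sub>2" by (simp_all add: multispaces_def)
  note dist = multispace_dist_eq_underlying_plus_height[OF W]
  show "multispace_dist W\<^sub>1 W\<^sub>2 \<ge> multispace_dist (underlying W\<^sub>1) (underlying W\<^sub>2)"
    "multispace_dist W\<^sub>1 W\<^sub>2 = multispace_dist (underlying W\<^sub>1) (underlying W\<^sub>2) \<longleftrightarrow>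
      mheight W\<^sub>1 = mheight W\<^sub>2"
    by (simp_all add: dist)
next
  fix m and W\<^sub>1 W\<^sub>2 :: "('a ^ 'n) multiset"
  assume "W\<^sub>1 \<in> multispaces_of_rank m" "W\<^sub>2 \<in> multispaces_of_rank m"
  then have W: "multispace W\<^sub>1" "multispace W\<^sub>2" and rank: "mrank W\<^sub>1 = m" "mrank W\<^sub>2 = m"
    by (simp_all add: multispaces_of_rank_def)
  let ?d = "multispace_dist W\<^sub>1 W\<^sub>2"
    and ?u = "multispace_dist (underlying W\<^sub>1) (underlying W\<^sub>2)"
  note bound = abs_mdim_diff_le_multispace_dist_underlying[OF W]
  \<comment> \<open>The common rank \<open>m\<close> cancels, so the height difference is the
    dimension difference up to sign.\<close>
  show dist: "?d = ?u + \<bar>int (mdim W\<^sub>1) - int (mdim W\<^sub>2)\<bar>"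
    using multispace_dist_eq_underlying_plus_height[OF W] by (simp add: mheight_def rank)
  show "?u \<le> ?d" "?u = ?d \<longleftrightarrow> mdim W\<^sub>1 = mdim W\<^sub>2"
    using dist by linarith+
  show "?d \<le> 2 * ?u"
    using dist bound(1) by linarith
  \<comment> \<open>By \<open>dist\<close>, the left side says that the dimension gap equals
    \<open>?u\<close>, the equality case of \<open>bound\<close>.\<close>
  show "?d = 2 * ?u \<longleftrightarrow> set_mset W\<^sub>1 \<subseteq> set_mset W\<^sub>2 \<or> set_mset W\<^sub>2 \<subseteq> set_mset W\<^sub>1"
    using dist unfolding bound(2)[symmetric] by linarith
qed

end
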